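(* Let $T>0$. For $i\in\{1,2\}$, let $S_i(t)$ be strongly continuous semigroups on $\mathcal{H}_{\mathrm u}$, let $B_i:\mathcal{H}_{\mathrm u}\to\mathcal{H}_{\mathrm r}$ and $C_i:\mathcal{H}_{\mathrm r}\to\mathcal{H}_{\mathrm u}$ be bounded linear operators, and let $y_{0,i}\in\mathcal{H}_{\mathrm u}$, $g_i\in L^1(0,T;\mathcal{H}_{\mathrm u})$. Set $$K_i(t):=B_iS_i(t)C_i,\qquad F_{\mathrm u,i}(t):=B_iS_i(t)y_{0,i}+B_i\int_0^tS_i(t-s)g_i(s)\,ds,$$ $$\delta_S(T):=\int_0^T\|S_1(t)-S_2(t)\|\,dt .$$ Assume that $\|S_i(t)\|\le\eta_T$ for $0\le t\le T$, $i=1,2$, for some $\eta_T\ge1$. Then $$\|K_1-K_2\|_{\mathscr K_T(\mathcal{H}_{\mathrm r})}\le T\eta_T\|B_1-B_2\|\,\|C_1\|+\|B_2\|\,\delta_S(T)\,\|C_1\|+T\eta_T\|B_2\|\,\|C_1-C_2\| .$$ Furthermore, $$\|F_{\mathrm u,1}-F_{\mathrm u,2}\|_{L^1(0,T;\mathcal{H}_{\mathrm r})}\le\Bigl[T\eta_T\|B_1-B_2\|+\|B_2\|\,\delta_S(T)\Bigr]\Bigl(\|y_{0,1}\|_{\mathcal{H}_{\mathrm u}}+\|g_1\|_{L^1(0,T;\mathcal{H}_{\mathrm u})}\Bigr)+T\eta_T\|B_2\|\Bigl(\|y_{0,1}-y_{0,2}\|_{\mathcal{H}_{\mathrm u}}+\|g_1-g_2\|_{L^1(0,T;\mathcal{H}_{\mathrm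 u})}\Bigr).$$
   Context: $\mathcal{H}_{\mathrm r}$ and $\mathcal{H}_{\mathrm u}$ are separable real Hilbert spaces. Norms of operators are operator norms. $\|K\|_{\mathscr K_T(\mathcal{H}_{\mathrm r})}:=\int_0^T\|K(t)\|\,dt$ for a function $K$ on $[0,T]$ with values in the bounded linear operators on $\mathcal{H}_{\mathrm r}$ such that $t\mapsto K(t)v$ is strongly measurable for every $v\in\mathcal{H}_{\mathrm r}$. *)

theory Defs
  imports "HOL-Analysis.Analysis"
begin

text \<open>
  Separable real Hilbert spaces are types of sort
  \<open>{real_inner, banach, second_countable_topology}\<close>: a metric space is separable iff it is
  second countable, and on such a space strong (Bochner) measurability is Borel measurability.
  Bounded linear operators are \<open>blinfun\<close>s, whose norm is the operator norm.
  Functions on \<open>[0,T]\<close> are total functions of which only the values on \<open>{0..T}\<close> matter,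
  with Lebesgue measure \<open>lebesgue_on {0..T}\<close>; elements of L1 are represented by functions.
\<close>

text \<open>Values at negative times are unconstrained.\<close>

definition C0_semigroup :: "(real \<Rightarrow> 'a::real_normed_vector \<Rightarrow>\<^sub>L 'a) \<Rightarrow> bool" where
  "C0_semigroup S \<longleftrightarrow>
     S 0 = id_blinfun \<and>
     (\<forall>s\<ge>0. \<forall>t\<ge>0. S (s + t) = S s o\<^sub>L S t) \<and>
     (\<forall>x. continuous_on {0..} (\<lambda>t. blinfun_apply (S t) x))"

text \<open>
  The map \<open>t \<mapsto> K t\<close> is only required to be measurable in the strong operator sense, not as a
  map into the (in general nonseparable) operator space; \<open>norm (K t)\<close> is a real function, so its
  integral makes sense. Integrability is spelled out because the integral of a nonintegrable
  function is 0 in the library.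
\<close>

definition kernel_space ::
  "real \<Rightarrow> (real \<Rightarrow> 'r \<Rightarrow>\<^sub>L 'r::{real_inner, banach, second_countable_topology}) \<Rightarrow> bool" where
  "kernel_space T K \<longleftrightarrow>
     (\<forall>v. (\<lambda>t. blinfun_apply (K t) v) \<in> borel_measurable (lebesgue_on {0..T})) \<and>
     integrable (lebesgue_on {0..T}) (\<lambda>t. norm (K t))"

definition kernel_norm ::
  "real \<Rightarrow> (real \<Rightarrow> 'r \<Rightarrow>\<^sub>L 'r::{real_inner, banach, second_countable_topology}) \<Rightarrow> real" where
  "kernel_norm T K = (LINT t|lebesgue_on {0..T}. norm (K t))"

definition L1_norm ::
  "real \<Rightarrow> (real \<Rightarrow> 'a::{real_inner, banach, second_countable_topology}) \<Rightarrow> real" where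
  "L1_norm T f = (LINT t|lebesgue_on {0..T}. norm (f t))"

definition memory_kernel ::
  "('u::real_normed_vector \<Rightarrow>\<^sub>L 'r::real_normed_vector) \<Rightarrow> (real \<Rightarrow> 'u \<Rightarrow>\<^sub>L 'u) \<Rightarrow> ('r \<Rightarrow>\<^sub>L 'u) \<Rightarrow>
    real \<Rightarrow> 'r \<Rightarrow>\<^sub>L 'r" where
  "memory_kernel B S C t = B o\<^sub>L S t o\<^sub>L C"

definition forcing ::
  "('u::{real_inner, banach, second_countable_topology} \<Rightarrow>\<^sub>L 'r::real_normed_vector) \<Rightarrow>
    (real \<Rightarrow> 'u \<Rightarrow>\<^sub>L 'u) \<Rightarrow> 'u \<Rightarrow> (real \<Rightarrow> 'u) \<Rightarrow> real \<Rightarrow> 'r" where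
  "forcing B S y0 g t =
     blinfun_apply B (blinfun_apply (S t) y0) +
     blinfun_apply B (LINT s|lebesgue_on {0..t}. blinfun_apply (S (t - s)) (g s))"

definition semigroup_gap ::
  "real \<Rightarrow> (real \<Rightarrow> 'u::real_normed_vector \<Rightarrow>\<^sub>L 'u) \<Rightarrow> (real \<Rightarrow> 'u \<Rightarrow>\<^sub>L 'u) \<Rightarrow> real" where
  "semigroup_gap T S1 S2 = (LINT t|lebesgue_on {0..T}. norm (S1 t - S2 t))"

end

theory Submission
  imports Defs
begin

text \<open>
  Both differences telescope through the data one at a time, first \<open>B\<close>, then \<open>S\<close>, then the remaining
  factor. In the forcing term, the only summand that a uniform bound does not settle is the
  convolution of \<open>S1 - S2\<close> with \<open>g1\<close>, for which Young's inequality gives \<open>semigroup_gap T S1 S2\<close> times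
  the L1 norm of \<open>g1\<close>. The function \<open>t \<mapsto> norm (S1 t - S2 t)\<close> need not be continuous, but as a
  supremum of continuous functions over a countable dense set it is Borel measurable.
\<close>

section \<open>Measurability and joint continuity of operator families\<close>

text \<open>Each strict superlevel set of the norm is a countable union, over a dense set
  \<open>D\<close> of test vectors, of sets that are measurable by assumption. Measurability on
  single vectors therefore suffices, although the operator space may be nonseparable.\<close>

lemma borel_measurable_norm_blinfun:
  fixes U :: "'b \<Rightarrow> 'a::{real_normed_vector, second_countable_topology} \<Rightarrow>\<^sub>L 'c::real_normed_vector"
  assumes "\<And>x. (\<lambda>t. norm (U t x)) \<in> borel_measurable M"
  shows "(\<lambda>t. norm (U t)) \<in> borel_measurable M"
proof -
  obtain D :: "'a set" where D: "countable D" "\<And>X. open X \<Longrightarrow> X \<noteq> {} \<Longrightarrow> \<exists>d\<in>D. d \<in> X"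
    by (rule countable_dense_setE) blast
  have "{t \<in> space M. c < norm (U t)} \<in> sets M" for c
  proof (cases "c < 0")
    case True
    then have "{t \<in> space M. c < norm (U t)} = space M"
      using norm_ge_zero less_le_trans by blast
    then show ?thesis by simp
  next
    case False
    \<comment> \<open>Writing the test as \<open>c * norm x < norm (U t x)\<close> avoids division
      and makes the set of good \<open>x\<close> open, so it meets \<open>D\<close> as soon as it is
      nonempty. If it were empty, \<open>c\<close>, being nonnegative here, would bound the operator
      norm.\<close>
    have "(\<exists>x\<in>D. c * norm x < norm (U t x)) \<longleftrightarrow> c < norm (U t)" for t
    proof
      assume "\<exists>x\<in>D. c * norm x < norm (U t x)"
      then obtain x where "c * norm x < norm (U t x)" by blast
      also have "\<dots> \<le> norm (U t) * norm x" by (rule norm_blinfun)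
      finally show "c < norm (U t)" by (simp add: mult_less_cancel_right)
    next
      assume less: "c < norm (U t)"
      have "open {x. c * norm x < norm (U t x)}"
        by (intro open_Collect_less continuous_intros)
      moreover have "{x. c * norm x < norm (U t x)} \<noteq> {}"
      proof
        assume "{x. c * norm x < norm (U t x)} = {}"
        then have "norm (U t x) \<le> c * norm x" for x
          by (metis (mono_tags, lifting) empty_iff mem_Collect_eq not_less)
        then have "norm (U t) \<le> c" using False by (intro norm_blinfun_bound) auto
        with less show False by simp
      qed
      ultimately show "\<exists>x\<in>D. c * norm x < norm (U t x)" using D(2) by blast
    qed
    then have "{t \<in> space M. c < norm (U t)} = (\<Union>x\<in>D. {t \<in> space M. c * norm x < norm (U t x)})"
      by blast
    also have "\<dots> \<in> sets M"
      using D(1) assms by (intro sets.countable_UN' borel_measurable_less) auto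
    finally show ?thesis .
  qed
  then show ?thesis by (simp add: borel_measurable_iff_greater)
qed

text \<open>Along a convergent sequence the value splits into the operators applied to the fixed
  limit vector, handled by strong continuity, and to a null sequence, killed by the uniform bound.
  Joint continuity later makes \<open>s \<mapsto> U (t - s) (g s)\<close> measurable.\<close>

lemma continuous_on_blinfun_pair:
  fixes U :: "real \<Rightarrow> 'a::real_normed_vector \<Rightarrow>\<^sub>L 'b::real_normed_vector"
  assumes cont: "\<And>x. continuous_on UNIV (\<lambda>t. U t x)" and bd: "\<And>t. norm (U t) \<le> M"
  shows "continuous_on UNIV (\<lambda>p. U (fst p) (snd p))"
proof (rule continuous_on_sequentiallyI)
  fix p :: "nat \<Rightarrow> real \<times> 'a" and a
  assume "p \<longlonglongrightarrow> a"
  then have 1: "(\<lambda>n. fst (p n)) \<longlonglongrightarrow> fst a" and 2: "(\<lambda>n. snd (p n)) \<longlonglongrightarrow> snd a"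
    by (auto intro: tendsto_fst tendsto_snd)
  have "(\<lambda>n. U (fst (p n)) (snd a)) \<longlonglongrightarrow> U (fst a) (snd a)"
    using cont[of "snd a"] 1 by (rule continuous_on_tendsto_compose) auto
  moreover have "(\<lambda>n. U (fst (p n)) (snd (p n) - snd a)) \<longlonglongrightarrow> 0"
  proof (rule Lim_null_comparison)
    show "\<forall>\<^sub>F n in sequentially. norm (U (fst (p n)) (snd (p n) - snd a)) \<le> M * norm (snd (p n) - snd a)"
      by (intro always_eventually allI order_trans[OF norm_blinfun] mult_right_mono bd norm_ge_zero)
    have "(\<lambda>n. M * norm (snd (p n) - snd a)) \<longlonglongrightarrow> M * norm (snd a - snd a)"
      by (intro tendsto_intros 2)
    then show "(\<lambda>n. M * norm (snd (p n) - snd a)) \<longlonglongrightarrow> 0" by simp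
  qed
  ultimately have "(\<lambda>n. U (fst (p n)) (snd a) + U (fst (p n)) (snd (p n) - snd a)) \<longlonglongrightarrow> U (fst a) (snd a) + 0"
    by (rule tendsto_add)
  then show "(\<lambda>n. U (fst (p n)) (snd (p n))) \<longlonglongrightarrow> U (fst a) (snd a)"
    by (simp add: blinfun.diff_right)
qed

section \<open>Convolutions of scalar functions and of operator families\<close>

text \<open>Tonelli and translation invariance; for nonnegative functions Young's inequality in L1
  is an equality.\<close>

lemma nn_integral_convolution:
  fixes u v :: "real \<Rightarrow> ennreal"
  assumes [measurable]: "u \<in> borel_measurable borel" and v: "v \<in> borel_measurable lebesgue"
  shows "(\<integral>\<^sup>+t. (\<integral>\<^sup>+s. u (t - s) * v s \<partial>lborel) \<partial>lborel) = (\<integral>\<^sup>+t. u t \<partial>lborel) * (\<integral>\<^sup>+s. v s \<partial>lborel)"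
proof -
  \<comment> \<open>Tonelli is applied to the product of Borel measures, so the merely Lebesgue
    measurable \<open>v\<close> gives way to a Borel function equal to it almost everywhere.\<close>
  obtain w where [measurable]: "w \<in> borel_measurable borel" and w: "AE s in lborel. v s = w s"
    using completion_ex_borel_measurable[OF v] by auto
  have "(\<integral>\<^sup>+t. (\<integral>\<^sup>+s. u (t - s) * v s \<partial>lborel) \<partial>lborel) = (\<integral>\<^sup>+t. (\<integral>\<^sup>+s. u (t - s) * w s \<partial>lborel) \<partial>lborel)"
    by (intro nn_integral_cong nn_integral_cong_AE eventually_mono[OF w]) simp
  also have "\<dots> = (\<integral>\<^sup>+s. (\<integral>\<^sup>+t. u (t - s) * w s \<partial>lborel) \<partial>lborel)"
    by (rule lborel_pair.Fubini') measurable
  also have "\<dots> = (\<integral>\<^sup>+s. (\<integral>\<^sup>+t. u t \<partial>lborel) * w s \<partial>lborel)"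
  proof (rule nn_integral_cong)
    fix s
    have "(\<integral>\<^sup>+t. u t \<partial>lborel) = (\<integral>\<^sup>+t. u (t - s) \<partial>lborel)"
      using nn_integral_real_affine[of u 1 "- s"] by simp
    then show "(\<integral>\<^sup>+t. u (t - s) * w s \<partial>lborel) = (\<integral>\<^sup>+t. u t \<partial>lborel) * w s"
      by (simp add: nn_integral_multc)
  qed
  also have "\<dots> = (\<integral>\<^sup>+t. u t \<partial>lborel) * (\<integral>\<^sup>+s. w s \<partial>lborel)"
    by (simp add: nn_integral_cmult)
  also have "(\<integral>\<^sup>+s. w s \<partial>lborel) = (\<integral>\<^sup>+s. v s \<partial>lborel)"
    by (intro nn_integral_cong_AE eventually_mono[OF w]) simp
  finally show ?thesis .
qed

text \<open>For a semigroup \<open>U\<close> and a source \<open>g\<close> this is the Duhamel term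
  of the mild solution.\<close>

definition operator_convolution ::
  "(real \<Rightarrow> 'a::real_normed_vector \<Rightarrow>\<^sub>L 'b::{real_inner, banach, second_countable_topology}) \<Rightarrow>
    (real \<Rightarrow> 'a) \<Rightarrow> real \<Rightarrow> 'b" where
  "operator_convolution U g t = (LINT s|lebesgue_on {0..t}. U (t - s) (g s))"

text \<open>The semigroup law is left out so that the difference of two semigroups qualifies as
  well. Continuity on the whole line gives a meaning to \<open>U (t - s)\<close> also for
  \<open>s > t\<close>.\<close>

locale strongly_continuous_family =
  fixes U :: "real \<Rightarrow> 'a::{real_inner, banach, second_countable_topology} \<Rightarrow>\<^sub>L
      'b::{real_inner, banach, second_countable_topology}"
    and M :: real
  assumes cont: "continuous_on UNIV (\<lambda>t. U t x)" and bound: "norm (U t) \<le> M"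
begin

lemma bound_nonneg: "M \<ge> 0"
  using norm_ge_zero bound order_trans by blast

lemma norm_apply_le: "norm (U t x) \<le> M * norm x"
  by (rule order_trans[OF norm_blinfun]) (simp add: bound mult_right_mono)

lemma norm_measurable: "(\<lambda>t. norm (U t)) \<in> borel_measurable borel"
  by (intro borel_measurable_norm_blinfun borel_measurable_continuous_onI continuous_on_norm cont)

lemma norm_measurable_on: "(\<lambda>t. norm (U t)) \<in> borel_measurable (lebesgue_on A)"
  using norm_measurable by (intro measurable_restrict_space1 measurable_completion) simp

lemma norm_integrable: "integrable (lebesgue_on {0..T}) (\<lambda>t. norm (U t))"
proof -
  interpret finite_measure "lebesgue_on {0..T}"
    by (rule finite_measure_lebesgue_on) simp
  show ?thesis
    by (rule integrable_const_bound[of _ M]) (auto simp: bound norm_measurable_on)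
qed

context
  fixes T :: real and g :: "real \<Rightarrow> 'a"
  assumes g: "integrable (lebesgue_on {0..T}) g"
begin

lemma convolution_integrand_measurable:
  "(\<lambda>s. U (t - s) (g s)) \<in> borel_measurable (lebesgue_on {0..T})"
proof (rule borel_measurable_continuous_Pair[where H = "\<lambda>r x. U r x"])
  show "(\<lambda>s. t - s) \<in> borel_measurable (lebesgue_on {0..T})"
    by (intro continuous_imp_measurable_on_sets_lebesgue continuous_intros) simp
  show "g \<in> borel_measurable (lebesgue_on {0..T})" using g by simp
  show "continuous_on UNIV (\<lambda>p. U (fst p) (snd p))"
    by (rule continuous_on_blinfun_pair[OF cont bound])
qed

lemma convolution_integrand_integrable:
  "integrable (lebesgue_on {0..T}) (\<lambda>s. indicator {..t} s *\<^sub>R U (t - s) (g s))"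
proof (rule Bochner_Integration.integrable_bound)
  show "integrable (lebesgue_on {0..T}) (\<lambda>s. M * norm (g s))" using g by simp
  show "(\<lambda>s. indicator {..t} s *\<^sub>R U (t - s) (g s)) \<in> borel_measurable (lebesgue_on {0..T})"
    by (intro borel_measurable_scaleR convolution_integrand_measurable measurable_restrict_space1
        borel_measurable_indicator) simp
  show "AE s in lebesgue_on {0..T}. norm (indicator {..t} s *\<^sub>R U (t - s) (g s)) \<le> norm (M * norm (g s))"
    using bound_nonneg by (auto simp: indicator_def norm_apply_le)
qed

text \<open>Moving the upper limit into an indicator gives all times \<open>t\<close> the same
  domain of integration, as dominated convergence requires.\<close>

lemma convolution_eq:
  assumes "0 \<le> t" "t \<le> T"
  shows "operator_convolution U g t = (LINT s|lebesgue_on {0..T}. indicator {..t} s *\<^sub>R U (t - s) (g s))"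
  unfolding operator_convolution_def
  using assms by (subst (1 2) integral_restrict_space)
    (auto intro!: Bochner_Integration.integral_cong simp: indicator_def)

lemma norm_convolution_le:
  assumes "0 \<le> t" "t \<le> T"
  shows "norm (operator_convolution U g t) \<le> M * L1_norm T g"
proof -
  have "norm (operator_convolution U g t)
      \<le> (LINT s|lebesgue_on {0..T}. norm (indicator {..t} s *\<^sub>R U (t - s) (g s)))"
    unfolding convolution_eq[OF assms] by (rule integral_norm_bound)
  also have "\<dots> \<le> (LINT s|lebesgue_on {0..T}. M * norm (g s))"
    using g bound_nonneg
    by (intro integral_mono integrable_norm convolution_integrand_integrable)
      (auto simp: indicator_def norm_apply_le)
  finally show ?thesis by (simp add: L1_norm_def)
qed

text \<open>Dominated convergence with majorant \<open>M * norm (g s)\<close>. Continuity provides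
  the measurability in \<open>t\<close> on which the later integrability claims rest.\<close>

lemma continuous_on_convolution: "continuous_on {0..T} (operator_convolution U g)"
proof (rule continuous_on_sequentiallyI)
  fix r :: "nat \<Rightarrow> real" and t
  assume r: "\<forall>n. r n \<in> {0..T}" "r \<longlonglongrightarrow> t" and t: "t \<in> {0..T}"
  have "(\<lambda>n. LINT s|lebesgue_on {0..T}. indicator {..r n} s *\<^sub>R U (r n - s) (g s))
      \<longlonglongrightarrow> (LINT s|lebesgue_on {0..T}. indicator {..t} s *\<^sub>R U (t - s) (g s))"
  proof (rule integral_dominated_convergence)
    show "integrable (lebesgue_on {0..T}) (\<lambda>s. M * norm (g s))" using g by simp
    show "(\<lambda>s. indicator {..r n} s *\<^sub>R U (r n - s) (g s)) \<in> borel_measurable (lebesgue_on {0..T})" for n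
      using convolution_integrand_integrable by auto
    show "(\<lambda>s. indicator {..t} s *\<^sub>R U (t - s) (g s)) \<in> borel_measurable (lebesgue_on {0..T})"
      using convolution_integrand_integrable by auto
    show "AE s in lebesgue_on {0..T}. norm (indicator {..r n} s *\<^sub>R U (r n - s) (g s)) \<le> M * norm (g s)" for n
      using bound_nonneg by (auto simp: indicator_def norm_apply_le)
    \<comment> \<open>At \<open>s = t\<close> the indicator of \<open>{..r n}\<close> may oscillate
      with the sign of \<open>r n - t\<close>; this single point is a null set.\<close>
    have lim: "(\<lambda>n. indicator {..r n} s *\<^sub>R U (r n - s) (g s)) \<longlonglongrightarrow> indicator {..t} s *\<^sub>R U (t - s) (g s)"
      if "s \<noteq> t" for s
    proof (rule tendsto_scaleR)
      have "(\<lambda>n. r n - s) \<longlonglongrightarrow> t - s" by (intro tendsto_intros r)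
      with cont show "(\<lambda>n. U (r n - s) (g s)) \<longlonglongrightarrow> U (t - s) (g s)"
        by (rule continuous_on_tendsto_compose) auto
      have "\<forall>\<^sub>F n in sequentially. (indicator {..r n} s :: real) = indicator {..t} s"
      proof (cases "s < t")
        case True
        from order_tendstoD(1)[OF r(2) True] show ?thesis
          by eventually_elim (use True in simp)
      next
        case False
        with that have "t < s" by simp
        from order_tendstoD(2)[OF r(2) this] show ?thesis
          by eventually_elim (use \<open>t < s\<close> in simp)
      qed
      then show "(\<lambda>n. indicator {..r n} s :: real) \<longlonglongrightarrow> indicator {..t} s"
        by (rule tendsto_eventually)
    qed
    have "AE s in lebesgue. s \<noteq> t"
      by (rule AE_completion) (rule AE_lborel_singleton)
    then show "AE s in lebesgue_on {0..T}.
        (\<lambda>n. indicator {..r n} s *\<^sub>R U (r n - s) (g s)) \<longlonglongrightarrow> indicator {..t} s *\<^sub>R U (t - s) (g s)"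
      by (subst AE_restrict_space_iff) (auto elim!: eventually_mono intro: lim)
  qed
  then show "(\<lambda>n. operator_convolution U g (r n)) \<longlonglongrightarrow> operator_convolution U g t"
    using r t by (simp add: convolution_eq)
qed

lemma integrable_norm_convolution:
  "integrable (lebesgue_on {0..T}) (\<lambda>t. norm (operator_convolution U g t))"
  by (intro continuous_imp_integrable_real continuous_on_norm continuous_on_convolution)

text \<open>Young's inequality: the norms of \<open>U\<close> and \<open>g\<close> are cut off to
  \<open>[0,T]\<close>, and the scalar identity for their convolution on the line is applied in
  \<open>ennreal\<close>.\<close>

lemma L1_norm_convolution_le:
  "L1_norm T (operator_convolution U g) \<le> (LINT t|lebesgue_on {0..T}. norm (U t)) * L1_norm T g"
proof -
  define u :: "real \<Rightarrow> ennreal" where "u t = ennreal (norm (U t)) * indicator {0..T} t" for t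
  define v :: "real \<Rightarrow> ennreal" where "v s = ennreal (norm (g s)) * indicator {0..T} s" for s
  have u: "(\<integral>\<^sup>+t. u t \<partial>lborel) = ennreal (LINT t|lebesgue_on {0..T}. norm (U t))"
    unfolding u_def
    by (subst nn_integral_eq_integral[OF norm_integrable, symmetric])
      (auto simp: nn_integral_restrict_space nn_integral_completion)
  have v: "(\<integral>\<^sup>+s. v s \<partial>lborel) = ennreal (L1_norm T g)"
    unfolding v_def L1_norm_def using g
    by (subst nn_integral_eq_integral[symmetric])
      (auto simp: nn_integral_restrict_space nn_integral_completion)
  have um: "u \<in> borel_measurable borel"
    unfolding u_def using norm_measurable by measurable
  have "(\<lambda>s. ennreal (norm (g s))) \<in> borel_measurable (lebesgue_on {0..T})"
    using g by auto
  then have vm: "v \<in> borel_measurable lebesgue"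
    unfolding v_def by (subst (asm) borel_measurable_restrict_space_iff_ennreal) auto
  \<comment> \<open>The cutoff in \<open>u\<close> loses nothing: where the indicator of
    \<open>{..t}\<close> is nonzero, \<open>0 \<le> s \<le> t \<le> T\<close>, so
    \<open>t - s\<close> lies in \<open>[0,T]\<close> too.\<close>
  have le: "ennreal (norm (operator_convolution U g t)) \<le> (\<integral>\<^sup>+s. u (t - s) * v s \<partial>lborel)"
    if t: "t \<in> {0..T}" for t
  proof -
    have "ennreal (norm (operator_convolution U g t))
        \<le> (\<integral>\<^sup>+s. norm (indicator {..t} s *\<^sub>R U (t - s) (g s)) \<partial>lebesgue_on {0..T})"
      using t convolution_eq by (simp add: integral_norm_bound_ennreal[OF convolution_integrand_integrable] del: norm_scaleR)
    also have "\<dots> = (\<integral>\<^sup>+s. ennreal (norm (indicator {..t} s *\<^sub>R U (t - s) (g s))) * indicator {0..T} s \<partial>lborel)"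
      by (simp add: nn_integral_restrict_space nn_integral_completion)
    also have "\<dots> \<le> (\<integral>\<^sup>+s. u (t - s) * v s \<partial>lborel)"
      using t by (intro nn_integral_mono)
        (auto simp: u_def v_def indicator_def norm_blinfun simp flip: ennreal_mult intro!: ennreal_leI)
    finally show ?thesis .
  qed
  have "ennreal (L1_norm T (operator_convolution U g))
      = (\<integral>\<^sup>+t. ennreal (norm (operator_convolution U g t)) \<partial>lebesgue_on {0..T})"
    unfolding L1_norm_def
    by (rule nn_integral_eq_integral[symmetric, OF integrable_norm_convolution]) simp
  also have "\<dots> = (\<integral>\<^sup>+t. ennreal (norm (operator_convolution U g t)) * indicator {0..T} t \<partial>lborel)"
    by (auto simp: nn_integral_restrict_space nn_integral_completion)
  \<comment> \<open>The outer integral is enlarged from \<open>[0,T]\<close> to the whole line,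
    where it factorizes.\<close>
  also have "\<dots> \<le> (\<integral>\<^sup>+t. (\<integral>\<^sup>+s. u (t - s) * v s \<partial>lborel) \<partial>lborel)"
    using le by (intro nn_integral_mono) (auto simp: indicator_def)
  also have "\<dots> = ennreal ((LINT t|lebesgue_on {0..T}. norm (U t)) * L1_norm T g)"
    unfolding nn_integral_convolution[OF um vm] u v
    by (simp add: ennreal_mult L1_norm_def)
  finally show ?thesis
    by (subst (asm) ennreal_le_iff) (auto simp: L1_norm_def)
qed

end

end

section \<open>Linearity of the operator convolution in both arguments\<close>

text \<open>The crude bound \<open>M + N\<close> secures integrability for the difference; its
  actual size enters later through the integral of its norm.\<close>

lemma strongly_continuous_family_diff:
  assumes "strongly_continuous_family U M" "strongly_continuous_family V N"
  shows "strongly_continuous_family (\<lambda>t. U t - V t) (M + N)"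
proof -
  interpret U: strongly_continuous_family U M by fact
  interpret V: strongly_continuous_family V N by fact
  show ?thesis
  proof
    show "continuous_on UNIV (\<lambda>t. (U t - V t) x)" for x
      unfolding blinfun.diff_left by (intro continuous_on_diff U.cont V.cont)
    show "norm (U t - V t) \<le> M + N" for t
      by (rule order_trans[OF norm_triangle_ineq4]) (intro add_mono U.bound V.bound)
  qed
qed

lemma operator_convolution_diff_left:
  assumes "strongly_continuous_family U M" "strongly_continuous_family V N"
    and g: "integrable (lebesgue_on {0..T}) g" and t: "0 \<le> t" "t \<le> T"
  shows "operator_convolution (\<lambda>t. U t - V t) g t = operator_convolution U g t - operator_convolution V g t"
proof -
  interpret U: strongly_continuous_family U M by fact
  interpret V: strongly_continuous_family V N by fact
  interpret UV: strongly_continuous_family "\<lambda>t. U t - V t" "M + N"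
    by (rule strongly_continuous_family_diff) fact+
  show ?thesis
    by (simp add: U.convolution_eq[OF g t] V.convolution_eq[OF g t] UV.convolution_eq[OF g t]
        blinfun.diff_left scaleR_diff_right
        U.convolution_integrand_integrable[OF g] V.convolution_integrand_integrable[OF g])
qed

lemma operator_convolution_diff_right:
  assumes "strongly_continuous_family U M"
    and g: "integrable (lebesgue_on {0..T}) g" and h: "integrable (lebesgue_on {0..T}) h"
    and t: "0 \<le> t" "t \<le> T"
  shows "operator_convolution U (\<lambda>s. g s - h s) t = operator_convolution U g t - operator_convolution U h t"
proof -
  interpret U: strongly_continuous_family U M by fact
  have gh: "integrable (lebesgue_on {0..T}) (\<lambda>s. g s - h s)" using g h by simp
  show ?thesis
    by (simp add: U.convolution_eq[OF g t] U.convolution_eq[OF h t] U.convolution_eq[OF gh t]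
        blinfun.diff_right scaleR_diff_right
        U.convolution_integrand_integrable[OF g] U.convolution_integrand_integrable[OF h])
qed

section \<open>Passage from semigroups to families on the whole line\<close>

text \<open>Freezing a semigroup outside \<open>[0,T]\<close> makes it strongly continuous and bounded on the whole line,
  where no constraint on the times has to be carried along.\<close>

definition clamped :: "real \<Rightarrow> (real \<Rightarrow> 'a) \<Rightarrow> real \<Rightarrow> 'a" where
  "clamped T S t = S (max 0 (min T t))"

lemma clamped_eq: "0 \<le> t \<Longrightarrow> t \<le> T \<Longrightarrow> clamped T S t = S t"
  by (simp add: clamped_def)

lemma strongly_continuous_family_clamped:
  fixes S :: "real \<Rightarrow> 'a \<Rightarrow>\<^sub>L 'a::{real_inner, banach, second_countable_topology}"
  assumes "C0_semigroup S" "T > 0" "\<And>t. 0 \<le> t \<Longrightarrow> t \<le> T \<Longrightarrow> norm (S t) \<le> M"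
  shows "strongly_continuous_family (clamped T S) M"
proof
  show "continuous_on UNIV (\<lambda>t. clamped T S t x)" for x
    unfolding clamped_def
  proof (rule continuous_on_compose2[where g = "\<lambda>t. S t x"])
    show "continuous_on {0..} (\<lambda>t. S t x)"
      using assms(1) by (simp add: C0_semigroup_def)
    show "continuous_on UNIV (\<lambda>t. max 0 (min T t))"
      by (intro continuous_intros)
  qed auto
  show "norm (clamped T S t) \<le> M" for t
    unfolding clamped_def using assms(2) by (intro assms(3)) auto
qed

text \<open>For \<open>s\<close> in \<open>[0,t]\<close> only times \<open>t - s\<close> in
  \<open>[0,T]\<close> occur, where clamping changes nothing.\<close>

lemma forcing_clamped:
  assumes "0 \<le> t" "t \<le> T"
  shows "forcing B S y g t = B (clamped T S t y + operator_convolution (clamped T S) g t)"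
proof -
  have "(LINT s|lebesgue_on {0..t}. S (t - s) (g s)) = operator_convolution (clamped T S) g t"
    unfolding operator_convolution_def using assms
    by (intro Bochner_Integration.integral_cong) (auto simp: clamped_eq)
  then show ?thesis using assms by (simp add: forcing_def clamped_eq blinfun.add_right)
qed

section \<open>Stability of the memory kernel and of the forcing term\<close>

theorem proposition5p1:
  fixes T \<eta> :: real
    and S1 S2 :: "real \<Rightarrow> 'u \<Rightarrow>\<^sub>L 'u::{real_inner, banach, second_countable_topology}"
    and B1 B2 :: "'u \<Rightarrow>\<^sub>L 'r::{real_inner, banach, second_countable_topology}"
    and C1 C2 :: "'r \<Rightarrow>\<^sub>L 'u"
    and y1 y2 :: 'u
    and g1 g2 :: "real \<Rightarrow> 'u"
  assumes "T > 0"
    and "C0_semigroup S1" and "C0_semigroup S2"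
    and "integrable (lebesgue_on {0..T}) g1" and "integrable (lebesgue_on {0..T}) g2"
    and "\<eta> \<ge> 1"
    and "\<And>t. 0 \<le> t \<Longrightarrow> t \<le> T \<Longrightarrow> norm (S1 t) \<le> \<eta>"
    and "\<And>t. 0 \<le> t \<Longrightarrow> t \<le> T \<Longrightarrow> norm (S2 t) \<le> \<eta>"
  shows "kernel_space T (\<lambda>t. memory_kernel B1 S1 C1 t - memory_kernel B2 S2 C2 t) \<and>
    kernel_norm T (\<lambda>t. memory_kernel B1 S1 C1 t - memory_kernel B2 S2 C2 t)
      \<le> T * \<eta> * norm (B1 - B2) * norm C1
        + norm B2 * semigroup_gap T S1 S2 * norm C1
        + T * \<eta> * norm B2 * norm (C1 - C2) \<and>
    integrable (lebesgue_on {0..T}) (\<lambda>t. forcing B1 S1 y1 g1 t - forcing B2 S2 y2 g2 t) \<and>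
    L1_norm T (\<lambda>t. forcing B1 S1 y1 g1 t - forcing B2 S2 y2 g2 t)
      \<le> (T * \<eta> * norm (B1 - B2) + norm B2 * semigroup_gap T S1 S2) * (norm y1 + L1_norm T g1)
        + T * \<eta> * norm B2 * (norm (y1 - y2) + L1_norm T (\<lambda>t. g1 t - g2 t))"
proof -
  let ?I = "lebesgue_on {0..T}"
  note T = assms(1) and g1 = assms(4) and g2 = assms(5)
  define V1 V2 where "V1 = clamped T S1" and "V2 = clamped T S2"
  define D where "D = (\<lambda>t. V1 t - V2 t)"
  define g where "g = (\<lambda>t. g1 t - g2 t)"
  have sc1: "strongly_continuous_family V1 \<eta>"
    unfolding V1_def by (rule strongly_continuous_family_clamped) fact+
  have sc2: "strongly_continuous_family V2 \<eta>"
    unfolding V2_def by (rule strongly_continuous_family_clamped) fact+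
  interpret V1: strongly_continuous_family V1 \<eta> by (rule sc1)
  interpret V2: strongly_continuous_family V2 \<eta> by (rule sc2)
  interpret D: strongly_continuous_family D "\<eta> + \<eta>"
    unfolding D_def by (rule strongly_continuous_family_diff) fact+
  interpret finite_measure ?I by (rule finite_measure_lebesgue_on) simp
  have g: "integrable ?I g" using g1 g2 by (simp add: g_def)
  \<comment> \<open>Every factor \<open>T\<close> in the two estimates comes from integrating a
    bound that is constant in time.\<close>
  have const: "(LINT t|?I. c) = T * c" for c :: real
    using T by (simp add: measure_restrict_space)
  have gap: "semigroup_gap T S1 S2 = (LINT t|?I. norm (D t))"
    unfolding semigroup_gap_def
    by (rule Bochner_Integration.integral_cong) (auto simp: D_def V1_def V2_def clamped_eq)

  define K where "K = (\<lambda>t. memory_kernel B1 S1 C1 t - memory_kernel B2 S2 C2 t)"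
  \<comment> \<open>Only the middle summand depends on \<open>t\<close>; its integral produces the
    semigroup gap.\<close>
  define kb where "kb t = \<eta> * norm (B1 - B2) * norm C1 + norm B2 * norm C1 * norm (D t)
    + \<eta> * norm B2 * norm (C1 - C2)" for t
  \<comment> \<open>Telescoping: \<open>B\<close> is exchanged first, then the semigroup, then
    \<open>C\<close>. This order is why \<open>C1\<close> and \<open>B2\<close>, rather than
    \<open>C2\<close> and \<open>B1\<close>, appear as factors in the estimate.\<close>
  have K: "K t = ((B1 - B2) o\<^sub>L V1 t o\<^sub>L C1) + (B2 o\<^sub>L D t o\<^sub>L C1) + (B2 o\<^sub>L V2 t o\<^sub>L (C1 - C2))"
    if "t \<in> {0..T}" for t
    using that
    by (intro blinfun_eqI)
      (simp add: K_def memory_kernel_def D_def V1_def V2_def clamped_eq blinfun.diff_left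
        blinfun.diff_right blinfun.add_left)
  have K_le: "norm (K t) \<le> kb t" if "t \<in> {0..T}" for t
  proof -
    have comp: "norm (A o\<^sub>L W o\<^sub>L C) \<le> norm A * norm W * norm C"
      for A :: "'u \<Rightarrow>\<^sub>L 'r" and W and C :: "'r \<Rightarrow>\<^sub>L 'u"
      by (rule order_trans[OF norm_blinfun_compose mult_right_mono[OF norm_blinfun_compose norm_ge_zero]])
    have "norm (K t) \<le> norm ((B1 - B2) o\<^sub>L V1 t o\<^sub>L C1) + norm (B2 o\<^sub>L D t o\<^sub>L C1)
        + norm (B2 o\<^sub>L V2 t o\<^sub>L (C1 - C2))"
      unfolding K[OF that] by (intro norm_triangle_mono order_refl)
    also have "\<dots> \<le> norm (B1 - B2) * norm (V1 t) * norm C1 + norm B2 * norm (D t) * norm C1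
        + norm B2 * norm (V2 t) * norm (C1 - C2)"
      by (intro add_mono comp)
    also have "\<dots> \<le> norm (B1 - B2) * \<eta> * norm C1 + norm B2 * norm (D t) * norm C1
        + norm B2 * \<eta> * norm (C1 - C2)"
      by (intro add_mono mult_right_mono mult_left_mono V1.bound V2.bound) auto
    finally show ?thesis by (simp add: kb_def mult_ac)
  qed
  have kb: "integrable ?I kb"
    unfolding kb_def using D.norm_integrable by simp
  have K_cont: "continuous_on {0..T} (\<lambda>t. K t v)" for v
  proof -
    have "continuous_on {0..T} (\<lambda>t. B1 (V1 t (C1 v)) - B2 (V2 t (C2 v)))"
      by (intro continuous_intros continuous_on_subset[OF V1.cont] continuous_on_subset[OF V2.cont]) auto
    then show ?thesis
      by (rule continuous_on_eq)
        (auto simp: K_def memory_kernel_def V1_def V2_def clamped_eq blinfun.diff_left)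
  qed
  have K_meas: "(\<lambda>t. K t v) \<in> borel_measurable ?I" for v
    by (intro continuous_imp_measurable_on_sets_lebesgue K_cont) simp
  \<comment> \<open>Strong measurability of \<open>K\<close> passes to its norm by the dense set
    argument; the majorant \<open>kb\<close> then gives integrability.\<close>
  have K_int: "integrable ?I (\<lambda>t. norm (K t))"
  proof (rule Bochner_Integration.integrable_bound[OF kb])
    show "(\<lambda>t. norm (K t)) \<in> borel_measurable ?I"
      by (intro borel_measurable_norm_blinfun measurable_compose[OF K_meas borel_measurable_norm])
    show "AE t in ?I. norm (norm (K t)) \<le> norm (kb t)"
      using K_le by (intro AE_I2) fastforce
  qed
  have "kernel_norm T K \<le> (LINT t|?I. kb t)"
    unfolding kernel_norm_def using K_le by (intro integral_mono K_int kb) auto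
  also have "\<dots> = T * (\<eta> * norm (B1 - B2) * norm C1) + norm B2 * norm C1 * (LINT t|?I. norm (D t))
      + T * (\<eta> * norm B2 * norm (C1 - C2))"
    unfolding kb_def using D.norm_integrable by (simp add: const del: lebesgue_integral_const)
  also have "\<dots> = T * \<eta> * norm (B1 - B2) * norm C1 + norm B2 * semigroup_gap T S1 S2 * norm C1
      + T * \<eta> * norm B2 * norm (C1 - C2)"
    by (simp add: gap mult_ac)
  finally have kernel_bound: "kernel_norm T K \<le> \<dots>" .

  define F where "F = (\<lambda>t. forcing B1 S1 y1 g1 t - forcing B2 S2 y2 g2 t)"
  \<comment> \<open>The convolution with \<open>D\<close> is kept unestimated: its uniform bound
    involves \<open>\<eta> + \<eta>\<close> and would lose the smallness of the gap. The other two
    summands use uniform bounds, with \<open>D t y1\<close> also kept as a function of time through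
    \<open>norm (D t)\<close>.\<close>
  define fb where "fb t = norm (B1 - B2) * (\<eta> * (norm y1 + L1_norm T g1))
    + norm B2 * (norm (D t) * norm y1 + norm (operator_convolution D g1 t))
    + norm B2 * (\<eta> * (norm (y1 - y2) + L1_norm T g))" for t
  have F_eq: "F t = B1 (V1 t y1 + operator_convolution V1 g1 t)
      - B2 (V2 t y2 + operator_convolution V2 g2 t)" if "t \<in> {0..T}" for t
    using that by (simp add: F_def V1_def V2_def forcing_clamped[where T = T])
  \<comment> \<open>The same telescoping, with the pair of initial value and source in the place of
    \<open>C\<close>.\<close>
  have F: "F t = (B1 - B2) (V1 t y1 + operator_convolution V1 g1 t)
      + B2 (D t y1 + operator_convolution D g1 t)
      + B2 (V2 t (y1 - y2) + operator_convolution V2 g t)" if "t \<in> {0..T}" for t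
    using that
    by (simp add: F_eq D_def g_def
        operator_convolution_diff_left[OF sc1 sc2 g1] operator_convolution_diff_right[OF sc2 g1 g2]
        blinfun.diff_left blinfun.diff_right blinfun.add_right)
  have F_le: "norm (F t) \<le> fb t" if t: "t \<in> {0..T}" for t
  proof -
    have app: "norm (A x) \<le> norm A * c" if "norm x \<le> c" for A :: "'u \<Rightarrow>\<^sub>L 'r" and x c
      by (rule order_trans[OF norm_blinfun mult_left_mono[OF that norm_ge_zero]])
    show ?thesis
      \<comment> \<open>Distributing \<open>\<eta>\<close> matches the semigroup term and the
        convolution each with its own uniform bound.\<close>
      unfolding F[OF t] fb_def distrib_left[of \<eta>] using t
      by (intro norm_triangle_mono app V1.norm_apply_le V2.norm_apply_le norm_blinfun order_refl
          V1.norm_convolution_le[OF g1] V2.norm_convolution_le[OF g]) auto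
  qed
  have fb: "integrable ?I fb"
    unfolding fb_def using D.norm_integrable D.integrable_norm_convolution[OF g1] by simp
  have "continuous_on {0..T} (\<lambda>t. B1 (V1 t y1 + operator_convolution V1 g1 t)
      - B2 (V2 t y2 + operator_convolution V2 g2 t))"
    by (intro continuous_intros continuous_on_subset[OF V1.cont] continuous_on_subset[OF V2.cont]
        V1.continuous_on_convolution[OF g1] V2.continuous_on_convolution[OF g2]) auto
  then have "continuous_on {0..T} F"
    by (rule continuous_on_eq) (simp add: F_eq)
  then have "F \<in> borel_measurable ?I"
    by (rule continuous_imp_measurable_on_sets_lebesgue) simp
  then have F_int: "integrable ?I F"
    using F_le by (intro Bochner_Integration.integrable_bound[OF fb] AE_I2) fastforce+
  have "L1_norm T F \<le> (LINT t|?I. fb t)"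
    unfolding L1_norm_def using F_le by (intro integral_mono integrable_norm F_int fb) auto
  also have "\<dots> = T * (norm (B1 - B2) * (\<eta> * (norm y1 + L1_norm T g1)))
      + norm B2 * ((LINT t|?I. norm (D t)) * norm y1 + L1_norm T (operator_convolution D g1))
      + T * (norm B2 * (\<eta> * (norm (y1 - y2) + L1_norm T g)))"
    unfolding fb_def using D.norm_integrable D.integrable_norm_convolution[OF g1]
    by (simp add: const L1_norm_def[of T "operator_convolution D g1"] del: lebesgue_integral_const)
  \<comment> \<open>Young's inequality for \<open>D\<close> and \<open>g1\<close> makes the gap a
    common factor of \<open>norm y1\<close> and the L1 norm of \<open>g1\<close>.\<close>
  also have "\<dots> \<le> T * (norm (B1 - B2) * (\<eta> * (norm y1 + L1_norm T g1)))
      + norm B2 * ((LINT t|?I. norm (D t)) * norm y1 + (LINT t|?I. norm (D t)) * L1_norm T g1)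
      + T * (norm B2 * (\<eta> * (norm (y1 - y2) + L1_norm T g)))"
    by (intro add_mono mult_left_mono D.L1_norm_convolution_le[OF g1] order_refl norm_ge_zero)
  also have "\<dots> = (T * \<eta> * norm (B1 - B2) + norm B2 * semigroup_gap T S1 S2) * (norm y1 + L1_norm T g1)
      + T * \<eta> * norm B2 * (norm (y1 - y2) + L1_norm T g)"
    by (simp add: gap algebra_simps)
  finally have "L1_norm T F \<le> \<dots>" .
  with K_meas K_int kernel_bound F_int show ?thesis
    unfolding kernel_space_def K_def F_def g_def by blast
qed

end
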